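(* Let $1\le h\le m$ be an integer. Let $\mathcal{X}_h$ be a maximizer of $v(\mathcal{X})$ over all $\mathcal{X}\subseteq\mathcal{C}=\{1,\dots,m\}$ with $|\mathcal{X}|\le h$, and let $\mathcal{T}_h$ be a set of $h$ indices $j\in\mathcal{C}$ having the largest values of $f_j t_j$ (ties broken arbitrarily). Then $$\frac{v(\mathcal{T}_h)}{v(\mathcal{X}_h)}\ \ge\ \frac1h .$$
   Context: Here $t_0=0<t_1\le\cdots\le t_m$ are real numbers, $f_1,\dots,f_m\in(0,1]$, and $Z_1,\dots,Z_m$ are independent Bernoulli random variables with $\Pr(Z_j=1)=f_j$. The portfolio valuation function is $v(\mathcal{X})=\operatorname{E}\bigl[\max\{t_0,\max\{t_jZ_j: j\in\mathcal{X}\}\}\bigr]$ for $\mathcal{X}\subseteq\mathcal{C}$, with $v(\varnothing)=t_0=0$. *)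

theory Defs
  imports "HOL-Probability.Probability"
begin

(* The law on the reals is the image of the Boolean Bernoulli distribution under True = 1,
   False = 0.  Measurability is required separately because distr is only meaningful for
   measurable functions. *)
definition bernoulli_rv :: "'w measure \<Rightarrow> real \<Rightarrow> ('w \<Rightarrow> real) \<Rightarrow> bool" where
  "bernoulli_rv M p X \<longleftrightarrow>
     X \<in> borel_measurable M \<and>
     distr M borel X = distr (measure_pmf (bernoulli_pmf p)) borel of_bool"

(* The outer maximum with t 0 is taken by inserting t 0 into the finite set of realized
   values, so that the empty portfolio has value t 0 (Max of the empty set is unspecified). *)
definition valuation ::
    "'w measure \<Rightarrow> (nat \<Rightarrow> real) \<Rightarrow> (nat \<Rightarrow> 'w \<Rightarrow> real) \<Rightarrow> nat set \<Rightarrow> real" where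
  "valuation M t Z X = (LINT w|M. Max (insert (t 0) ((\<lambda>j. t j * Z j w) ` X)))"

end

theory Submission
  imports Defs
begin

text \<open>
  Pointwise, the largest realized value lies between each single \<open>t\<^sub>j Z\<^sub>j\<close> and, as the values are almost
  surely nonnegative, the sum of all of them. Taking expectations,
  \<open>f\<^sub>j t\<^sub>j \<le> v(T)\<close> for every \<open>j \<in> T\<close>, hence by the choice of \<open>T\<close> for every \<open>j\<close>, and so
  \<open>v(X) \<le> (\<Sum>j\<in>X. f\<^sub>j t\<^sub>j) \<le> h v(T)\<close>.
\<close>

text \<open>Integrability and mean depend only on the law: both are statements about the identity
  function under \<open>distr M borel X\<close>, which rewrites to the image of a pmf on the finite
  type \<open>bool\<close>.\<close>

lemma bernoulli_rv_has_bochner_integral: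
  assumes "bernoulli_rv M p X" "0 \<le> p" "p \<le> 1"
  shows "has_bochner_integral M X p"
proof -
  let ?D = "measure_pmf (bernoulli_pmf p)"
  have X [measurable]: "X \<in> borel_measurable M"
    and D: "distr M borel X = distr ?D borel of_bool"
    using assms(1) by (auto simp: bernoulli_rv_def)
  have "integrable ?D (of_bool :: bool \<Rightarrow> real)"
    by (rule integrable_measure_pmf_finite) auto
  then have "integrable (distr M borel X) (\<lambda>x. x)"
    unfolding D by (subst integrable_distr_eq) auto
  then have int: "integrable M X"
    by (subst (asm) integrable_distr_eq) auto
  have "integral\<^sup>L M X = integral\<^sup>L (distr M borel X) (\<lambda>x. x)"
    by (subst integral_distr) auto
  also have "\<dots> = integral\<^sup>L ?D of_bool"
    unfolding D by (subst integral_distr) auto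
  also have "\<dots> = p"
    using assms(2,3) by simp
  finally show ?thesis
    using int by (simp add: has_bochner_integral_iff)
qed

text \<open>The law of \<open>X\<close> is carried by 0 and 1. As only the law is prescribed,
  negative values on a null set remain possible, hence the almost-sure form.\<close>

lemma bernoulli_rv_AE_nonneg:
  assumes "bernoulli_rv M p X"
  shows "AE w in M. 0 \<le> X w"
proof -
  have X [measurable]: "X \<in> borel_measurable M"
    and D: "distr M borel X = distr (measure_pmf (bernoulli_pmf p)) borel of_bool"
    using assms by (auto simp: bernoulli_rv_def)
  have "AE x in distr M borel X. 0 \<le> x"
    unfolding D by (subst AE_distr_iff) auto
  then show ?thesis
    by (subst (asm) AE_distr_iff) auto
qed

lemma integrable_Max_insert:
  fixes g :: "'a \<Rightarrow> 'w \<Rightarrow> real"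
  assumes "finite X" "integrable M (\<lambda>_. c)" "\<And>j. j \<in> X \<Longrightarrow> integrable M (g j)"
  shows "integrable M (\<lambda>w. Max (insert c ((\<lambda>j. g j w) ` X)))"
  using assms
proof (induction X rule: finite_induct)
  case empty
  then show ?case by simp
next
  case (insert x X)
  have "Max (insert c ((\<lambda>j. g j w) ` insert x X))
      = max (g x w) (Max (insert c ((\<lambda>j. g j w) ` X)))" for w
    \<comment> \<open>Swapping \<open>c\<close> behind the new element lets
      \<open>Max_insert\<close> peel off \<open>g x w\<close> and leave the maximum of the induction
      hypothesis, with \<open>c\<close> still in it.\<close>
    using insert.hyps by (simp add: insert_commute[of c] del: Max_insert) (subst Max_insert, auto)
  then show ?case
    using insert by (simp add: integrable_max)
qed

lemma Max_insert_0_le_sum: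
  fixes g :: "'a \<Rightarrow> real"
  assumes "finite X" "\<And>j. j \<in> X \<Longrightarrow> 0 \<le> g j"
  shows "Max (insert 0 (g ` X)) \<le> sum g X"
  using assms by (auto simp: sum_nonneg intro: member_le_sum)

text \<open>Monotonicity of the integral: \<open>t j * Z j w\<close> is one of the values over which
  the maximum is taken, and its mean is \<open>f j * t j\<close>.\<close>

lemma mult_le_valuation:
  assumes "prob_space M" "finite X" "j \<in> X"
    and "\<And>i. i \<in> X \<Longrightarrow> has_bochner_integral M (Z i) (f i)"
  shows "f j * t j \<le> valuation M t Z X"
proof -
  interpret prob_space M by fact
  have int: "integrable M (Z i)" if "i \<in> X" for i
    using assms(4)[OF that] by (simp add: has_bochner_integral_iff)
  have "f j * t j = (LINT w|M. t j * Z j w)"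
    using assms(4)[OF assms(3)] by (simp add: has_bochner_integral_iff)
  also have "\<dots> \<le> valuation M t Z X"
    unfolding valuation_def
  proof (rule integral_mono)
    show "integrable M (\<lambda>w. t j * Z j w)"
      using int assms(3) by simp
    show "integrable M (\<lambda>w. Max (insert (t 0) ((\<lambda>j. t j * Z j w) ` X)))"
      using assms(2) int by (intro integrable_Max_insert) auto
    show "t j * Z j w \<le> Max (insert (t 0) ((\<lambda>j. t j * Z j w) ` X))" for w
      using assms(2,3) by (intro Max_ge) auto
  qed
  finally show ?thesis .
qed

lemma valuation_le_sum:
  assumes "prob_space M" "finite X" "t 0 = 0"
    and "\<And>j. j \<in> X \<Longrightarrow> 0 \<le> t j"
    and "\<And>j. j \<in> X \<Longrightarrow> has_bochner_integral M (Z j) (f j)"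
    and "\<And>j. j \<in> X \<Longrightarrow> AE w in M. 0 \<le> Z j w"
  shows "valuation M t Z X \<le> (\<Sum>j\<in>X. f j * t j)"
proof -
  interpret prob_space M by fact
  have int: "integrable M (Z j)" and expectation_Z: "integral\<^sup>L M (Z j) = f j" if "j \<in> X" for j
    using assms(5)[OF that] by (simp_all add: has_bochner_integral_iff)
  \<comment> \<open>Finitely many exceptional null sets are merged into one, so that the pointwise
    bound applies to all of \<open>X\<close> at once.\<close>
  have "AE w in M. \<forall>j\<in>X. 0 \<le> Z j w"
    using assms(2,6) by (simp add: AE_finite_all)
  then have le: "AE w in M. Max (insert (t 0) ((\<lambda>j. t j * Z j w) ` X)) \<le> (\<Sum>j\<in>X. t j * Z j w)"
    by eventually_elim (unfold assms(3), rule Max_insert_0_le_sum, use assms(2,4) in auto)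
  have "valuation M t Z X \<le> (LINT w|M. (\<Sum>j\<in>X. t j * Z j w))"
    unfolding valuation_def
    using assms(2) int le by (intro integral_mono_AE integrable_Max_insert) auto
  also have "\<dots> = (\<Sum>j\<in>X. f j * t j)"
    using int by (simp add: Bochner_Integration.integral_sum expectation_Z mult.commute)
  finally show ?thesis .
qed

theorem theorem2:
  fixes M :: "'w measure"
    and Z :: "nat \<Rightarrow> 'w \<Rightarrow> real"
    and t f :: "nat \<Rightarrow> real"
    and m h :: nat
    and Xh Th :: "nat set"
  assumes "prob_space M"
    and "t 0 = 0"
    and "0 < t 1"
    and "mono_on {1..m} t"
    and "\<And>j. j \<in> {1..m} \<Longrightarrow> 0 < f j \<and> f j \<le> 1"
    and "\<And>j. j \<in> {1..m} \<Longrightarrow> bernoulli_rv M (f j) (Z j)"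
    and "prob_space.indep_vars M (\<lambda>_. borel) Z {1..m}"
    and "1 \<le> h" and "h \<le> m"
    and "is_arg_max (valuation M t Z) (\<lambda>X. X \<subseteq> {1..m} \<and> card X \<le> h) Xh"
    and "Th \<subseteq> {1..m}" and "card Th = h"
    and "\<And>i j. i \<in> Th \<Longrightarrow> j \<in> {1..m} - Th \<Longrightarrow> f j * t j \<le> f i * t i"
  shows "valuation M t Z Th / valuation M t Z Xh \<ge> 1 / real h"
proof -
  let ?v = "valuation M t Z"
  have Z: "has_bochner_integral M (Z j) (f j)" if "j \<in> {1..m}" for j
    using assms(5,6)[OF that] by (intro bernoulli_rv_has_bochner_integral) auto
  have t_nonneg: "0 \<le> t j" if "j \<in> {1..m}" for j
    using mono_onD[OF assms(4), of 1 j] that assms(3) by auto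
  have le_vT: "f j * t j \<le> ?v Th" if j: "j \<in> {1..m}" for j
  proof -
    have fin: "finite Th" "Th \<noteq> {}"
      using assms(8,12) by (auto intro: card_ge_0_finite)
    have T: "f i * t i \<le> ?v Th" if "i \<in> Th" for i
      using assms(1) fin(1) that Z assms(11) by (intro mult_le_valuation) auto
    show ?thesis
      \<comment> \<open>An index outside \<open>Th\<close> is dominated by any member of
        \<open>Th\<close>, and one exists because \<open>h\<close> is at least 1.\<close>
      using T fin(2) assms(13)[of _ j] j by (metis Diff_iff ex_in_conv order_trans)
  qed
  \<comment> \<open>The singleton \<open>{1}\<close> is a feasible competitor. Its value is
    positive, which makes the denominator \<open>?v Xh\<close> positive; with a zero denominator the
    quotient would be 0 and the claim false.\<close>
  have X: "Xh \<subseteq> {1..m}" "card Xh \<le> h" and X_max: "\<not> ?v Xh < ?v {1}"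
    using assms(8-10) by (auto simp: is_arg_max_def)
  have fin_X: "finite Xh"
    using X(1) finite_subset by blast
  have "0 < f 1 * t 1"
    using assms(3) assms(5)[of 1] assms(8,9) by simp
  also have "\<dots> \<le> ?v {1}"
    using assms(1,8,9) Z by (intro mult_le_valuation) auto
  finally have vX_pos: "0 < ?v Xh"
    using X_max by linarith
  \<comment> \<open>The sign matters because \<open>Xh\<close> may have fewer than \<open>h\<close>
    elements: it allows \<open>card Xh\<close> to be raised to \<open>h\<close> below.\<close>
  have vT_nonneg: "0 \<le> ?v Th"
    using \<open>0 < f 1 * t 1\<close> le_vT[of 1] assms(8,9) by simp
  have "?v Xh \<le> (\<Sum>j\<in>Xh. f j * t j)"
    using assms(1,2) fin_X X(1) Z t_nonneg bernoulli_rv_AE_nonneg[OF assms(6)]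
    by (intro valuation_le_sum) auto
  also have "\<dots> \<le> real (card Xh) * ?v Th"
    using X(1) le_vT by (intro sum_bounded_above) auto
  also have "\<dots> \<le> real h * ?v Th"
    using X(2) vT_nonneg by (intro mult_right_mono) auto
  finally show ?thesis
    using vX_pos assms(8) by (simp add: field_simps)
qed

end
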